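(* For every $n\ge 1$ there exists a (repetitive) Meyer set $X$ in $\mathbb{R}^n$ with $$M_X(T)=O\left(T(\log T)^{2/n}(\log\log\log T)^{4/n}\right)\quad\text{as }T\to\infty$$ that does not have uniform patch frequencies.
   Context: A Delone set in $\mathbb{R}^n$ is a set $X\subset\mathbb{R}^n$ for which there are $r,R>0$ such that each open ball of radius $r$ contains at most one point of $X$ and each closed ball of radius $R$ contains at least one point of $X$. A Meyer set is a Delone set $X$ such that $X-X=\{\mathbf{x}-\mathbf{y}:\mathbf{x},\mathbf{y}\in X\}$ is also a Delone set. $B(\mathbf{x};T)$ is the closed ball of radius $T$ centered at $\mathbf{x}$, and $\kappa_n$ is the volume of the unit ball in $\mathbb{R}^n$. $X$ is repetitive if for each $T>0$ there is a finite $M>0$ such that every closed ball of radius $M$ in $\mathbb{R}^n$ contains, for every $\mathbf{y}\in X$, some $\mathbf{x}\in X$ with $(X\cap B(\mathbf{x};T))-\mathbf{x}=(X\cap B(\mathbf{y};T))-\mathbf{y}$; $M_X(T)$ denotes the least such $M$. A $T$-patch of $X$ translated to the origin is a set $\mathcal{P}=(X\cap B(\mathbf{y};T))-\mathbf{y}$ with $\mathbf{y}\in X$. For such $\mathcal{P}$ and a bounded region $D\subset\mathbb{R}^n$, $n_{\mathcal{P}}(D)$ is the number of points $\mathbf{x}\in X\cap D$ with $(X\cap B(\mathbf{x};T))-\mathbf{x}=\mathcal{P}$. $X$ has uniform patch frequencies if for every $T>0$ and every such $\mathcal{P}$ there is a number $f(\mathcal{P})$ with $n_{\mathcal{P}}(B(\mathbf{t};U))/(\kappa_nU^n)=f(\mathcal{P})+o(1)$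 as $U\to\infty$, uniformly in $\mathbf{t}\in\mathbb{R}^n$. *)

theory Defs
  imports "HOL-Analysis.Analysis" "HOL-Library.Landau_Symbols"
begin

definition delone_set :: "'a::euclidean_space set \<Rightarrow> bool" where
  "delone_set X \<longleftrightarrow>
     (\<exists>r>0. \<exists>R>0.
        (\<forall>c. \<forall>x \<in> X \<inter> ball c r. \<forall>y \<in> X \<inter> ball c r. x = y) \<and>
        (\<forall>c. X \<inter> cball c R \<noteq> {}))"

definition meyer_set :: "'a::euclidean_space set \<Rightarrow> bool" where
  "meyer_set X \<longleftrightarrow> delone_set X \<and> delone_set {x - y |x y. x \<in> X \<and> y \<in> X}"

definition patch :: "'a::euclidean_space set \<Rightarrow> real \<Rightarrow> 'a \<Rightarrow> 'a set" where
  "patch X T y = (\<lambda>z. z - y) ` (X \<inter> cball y T)"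

definition repetitivity_radius :: "'a::euclidean_space set \<Rightarrow> real \<Rightarrow> real \<Rightarrow> bool" where
  "repetitivity_radius X T M \<longleftrightarrow>
     M > 0 \<and> (\<forall>c. \<forall>y\<in>X. \<exists>x \<in> X \<inter> cball c M. patch X T x = patch X T y)"

definition repetitive :: "'a::euclidean_space set \<Rightarrow> bool" where
  "repetitive X \<longleftrightarrow> (\<forall>T>0. \<exists>M. repetitivity_radius X T M)"

definition repetitivity_function :: "'a::euclidean_space set \<Rightarrow> real \<Rightarrow> real" where
  "repetitivity_function X T = (LEAST M. repetitivity_radius X T M)"

text \<open>
  Over the reals a least element need not exist in general; for repetitive Delone sets it does,
  because the balls are closed and the set is locally finite.
\<close>

lemma delone_set_finite_Int_cball:
  fixes X :: "'a::euclidean_space set"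
  assumes "delone_set X"
  shows "finite (X \<inter> cball c M)"
proof -
  obtain r where r: "r > 0" "\<And>c x y. x \<in> X \<inter> ball c r \<Longrightarrow> y \<in> X \<inter> ball c r \<Longrightarrow> x = y"
    using assms unfolding delone_set_def by meson
  have "compact (cball c M)" by simp
  then obtain k where k: "finite k" "cball c M \<subseteq> (\<Union>x\<in>k. ball x r)"
    using r(1) unfolding compact_eq_totally_bounded by meson
  have "finite (X \<inter> ball x r)" for x
  proof (cases "X \<inter> ball x r = {}")
    case False
    then obtain z where "z \<in> X \<inter> ball x r" by blast
    then have "X \<inter> ball x r \<subseteq> {z}" using r(2) by blast
    then show ?thesis by (rule finite_subset) simp
  qed simp
  then have "finite (\<Union>x\<in>k. X \<inter> ball x r)" using k(1) by blast
  moreover have "X \<inter> cball c M \<subseteq> (\<Union>x\<in>k. X \<inter> ball x r)" using k(2) by blast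
  ultimately show ?thesis by (rule rev_finite_subset)
qed

lemma repetitivity_function_least:
  fixes X :: "'a::euclidean_space set"
  assumes X: "delone_set X" "repetitive X" and T: "T > 0"
  shows "repetitivity_radius X T (repetitivity_function X T)"
    and "repetitivity_radius X T M \<Longrightarrow> repetitivity_function X T \<le> M"
proof -
  define S where "S = {M. repetitivity_radius X T M}"
  define m where "m = Inf S"
  have ne: "S \<noteq> {}" using X(2) T by (auto simp: S_def repetitive_def)
  have bdd: "bdd_below S"
    by (rule bdd_belowI[of _ 0]) (auto simp: S_def repetitivity_radius_def)
  have lower: "m \<le> M" if "M \<in> S" for M
    using that bdd by (simp add: m_def cInf_lower)
  have hit: "\<exists>x \<in> X \<inter> cball c m. patch X T x = patch X T y" if "y \<in> X" for c y
  proof (rule ccontr)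
    assume no: "\<not> ?thesis"
    define F where "F = {x \<in> X \<inter> cball c (m + 1). patch X T x = patch X T y}"
    have F: "finite F"
      by (rule finite_subset[OF _ delone_set_finite_Int_cball[OF X(1), of c "m + 1"]]) (auto simp: F_def)
    define d where "d = Min (insert (m + 1) (dist c ` F))"
    have "m < dist c x" if "x \<in> F" for x
      using that no by (auto simp: F_def not_le[symmetric])
    then have "m < d" using F by (simp add: d_def)
    then obtain M where M: "M \<in> S" "M < d"
      using cInf_lessD[OF ne] unfolding m_def by blast
    then obtain x where x: "x \<in> X" "dist c x \<le> M" "patch X T x = patch X T y"
      using \<open>y \<in> X\<close> by (fastforce simp: S_def repetitivity_radius_def)
    have "d \<le> m + 1" using F by (simp add: d_def)
    then have "x \<in> F" using x M by (simp add: F_def)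
    then have "d \<le> dist c x" using F by (simp add: d_def)
    then show False using x M by simp
  qed
  obtain r where r: "r > 0" "\<And>c x y. x \<in> X \<inter> ball c r \<Longrightarrow> y \<in> X \<inter> ball c r \<Longrightarrow> x = y"
    using X(1) unfolding delone_set_def by meson
  obtain y where y: "y \<in> X" using X(1) unfolding delone_set_def by blast
  have "m > 0"
  proof (rule ccontr)
    assume "\<not> m > 0"
    then have all: "c \<in> X" for c
      using hit[OF y, of c] by (metis IntE dist_le_zero_iff mem_cball not_less order_trans)
    obtain b :: 'a where b: "b \<in> Basis" using nonempty_Basis by blast
    have "(r/2) *\<^sub>R b = 0"
      using r b by (intro r(2)[of _ 0]) (auto simp: all)
    then show False using r(1) b by auto
  qed
  then have least: "repetitivity_radius X T m"
    using hit by (simp add: repetitivity_radius_def)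
  have "repetitivity_function X T = m"
    unfolding repetitivity_function_def
    by (rule Least_equality) (use least lower in \<open>auto simp: S_def\<close>)
  then show "repetitivity_radius X T (repetitivity_function X T)"
    and "repetitivity_radius X T M \<Longrightarrow> repetitivity_function X T \<le> M"
    using least lower by (auto simp: S_def)
qed

definition patch_count ::
    "'a::euclidean_space set \<Rightarrow> real \<Rightarrow> 'a set \<Rightarrow> 'a set \<Rightarrow> nat" where
  "patch_count X T P D = card {x \<in> X \<inter> D. patch X T x = P}"

definition uniform_patch_frequencies :: "'a::euclidean_space set \<Rightarrow> bool" where
  "uniform_patch_frequencies X \<longleftrightarrow>
     (\<forall>T>0. \<forall>P \<in> patch X T ` X. \<exists>f.
        uniform_limit UNIV
          (\<lambda>U t. real (patch_count X T P (cball t U)) / (measure lborel (cball (0::'a) 1) * U ^ DIM('a)))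
          (\<lambda>t. f) at_top)"

end

theory Submission
  imports Defs "HOL-Real_Asymp.Real_Asymp"
begin

text \<open>
  The set consists of the points of one colour in a two-colouring of the integer lattice, which makes
  it Meyer. The colouring is hierarchical: cubes of side \<open>L\<^sub>k\<close> come in two kinds, and a cube of side
  \<open>L\<^sub>k\<^sub>+\<^sub>1 = m\<^sub>k L\<^sub>k\<close> of a given kind consists of smaller cubes of the same kind, except in a corner
  region of bounded size, which displays every two-colouring of a \<open>2 \<times> \<dots> \<times> 2\<close> array of smaller cubes.
  A patch of radius \<open>T < L\<^sub>k / 2\<close> lies in such an array, so it recurs in every cube of side \<open>L\<^sub>k\<^sub>+\<^sub>1\<close>
  and \<open>M(T) = O(L\<^sub>k\<^sub>+\<^sub>1)\<close>, which is \<open>O(T m\<^sub>k\<^sub>-\<^sub>1 m\<^sub>k)\<close> for the least such \<open>k\<close>. The exceptional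
  fraction at level \<open>k\<close> is of order \<open>m\<^sub>k\<^sup>-\<^sup>n\<close>; if the sum of these is small, then large cubes of the two
  kinds have different densities, so frequencies are not uniform. Taking \<open>m\<^sub>k\<^sup>n\<close> of order
  \<open>k log k (log log k)\<^sup>2\<close> keeps the sum finite, and as \<open>log L\<^sub>k\<close> has order at least \<open>k log k\<close> this is
  \<open>O(log T (log log log T)\<^sup>2)\<close>.
\<close>

section \<open>Subsets of the integer lattice\<close>

lemma finite_box_fun:
  fixes S :: "'n::finite \<Rightarrow> 'b set"
  assumes "\<And>j. finite (S j)"
  shows "finite {f. \<forall>j. f j \<in> S j}" and "card {f. \<forall>j. f j \<in> S j} = (\<Prod>j\<in>UNIV. card (S j))"
proof -
  have eq: "{f. \<forall>j. f j \<in> S j} = Pi\<^sub>E UNIV S"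
    by (auto simp: PiE_def Pi_def extensional_def)
  show "finite {f. \<forall>j. f j \<in> S j}" unfolding eq using assms by (intro finite_PiE) auto
  show "card {f. \<forall>j. f j \<in> S j} = (\<Prod>j\<in>UNIV. card (S j))"
    unfolding eq by (simp add: card_PiE)
qed

text \<open>Lattice points are handled as integer-valued functions, on which \<open>div\<close> and
  \<open>mod\<close> act coordinatewise; this map embeds them in Euclidean space.\<close>

definition of_int_vec :: "('n::finite \<Rightarrow> int) \<Rightarrow> real ^ 'n" where
  "of_int_vec x = (\<chi> j. of_int (x j))"

lemma of_int_vec_nth [simp]: "of_int_vec x $ j = of_int (x j)"
  by (simp add: of_int_vec_def)

lemma inj_of_int_vec: "inj of_int_vec"
  by (auto simp: inj_def vec_eq_iff)

lemma norm_le_card_mult: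
  fixes v :: "real ^ 'n::finite"
  assumes "\<And>j. \<bar>v $ j\<bar> \<le> s"
  shows "norm v \<le> real CARD('n) * s"
  using norm_le_l1_cart[of v] sum_bounded_above[of UNIV "\<lambda>j. \<bar>v $ j\<bar>" s] assms by simp

lemma of_int_vec_dist_ge_1:
  assumes "x \<noteq> y"
  shows "1 \<le> dist (of_int_vec x) (of_int_vec y)"
proof -
  obtain j where j: "x j \<noteq> y j" using assms by auto
  then have "1 \<le> \<bar>x j - y j\<bar>" by linarith
  then have "1 \<le> \<bar>real_of_int (x j - y j)\<bar>" by linarith
  also have "\<dots> = \<bar>(of_int_vec x - of_int_vec y) $ j\<bar>" by simp
  also have "\<dots> \<le> dist (of_int_vec x) (of_int_vec y)"
    unfolding dist_norm by (rule component_le_norm_cart)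
  finally show ?thesis .
qed

lemma delone_set_of_int_vec:
  assumes sub: "X \<subseteq> range of_int_vec" and R: "R > 0" "\<And>c. X \<inter> cball c R \<noteq> {}"
  shows "delone_set X"
proof -
  \<comment> \<open>Points of an open ball of radius 1/2 are strictly less than 1 apart, which
    distinct lattice points never are.\<close>
  have "x = y" if "x \<in> X \<inter> ball c (1/2)" "y \<in> X \<inter> ball c (1/2)" for c x y
  proof -
    have xy: "x \<in> X" "y \<in> X" using that by auto
    have "dist x y < 1" using that dist_triangle2[of x y c] by (auto simp: dist_commute)
    moreover obtain a b where "x = of_int_vec a" "y = of_int_vec b" using xy sub by blast
    ultimately show ?thesis using of_int_vec_dist_ge_1[of a b] by fastforce
  qed
  then show ?thesis unfolding delone_set_def using R
    by (intro exI[of _ "1/2"] conjI exI[of _ R]) auto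
qed

text \<open>Differences of lattice points are lattice points, and the difference set contains a
  translate of \<open>X\<close>, so it is relatively dense with the same radius
  \<open>R\<close>.\<close>

lemma meyer_set_of_int_vec:
  assumes sub: "X \<subseteq> range of_int_vec" and R: "R > 0" "\<And>c. X \<inter> cball c R \<noteq> {}"
  shows "meyer_set X"
  unfolding meyer_set_def
proof
  show "delone_set X" using assms by (rule delone_set_of_int_vec)
  let ?D = "{x - y |x y. x \<in> X \<and> y \<in> X}"
  show "delone_set ?D"
  proof (rule delone_set_of_int_vec[OF _ R(1)])
    show "?D \<subseteq> range of_int_vec"
    proof safe
      fix x y assume "x \<in> X" "y \<in> X"
      then obtain a b where "x = of_int_vec a" "y = of_int_vec b" using sub by blast
      then have "x - y = of_int_vec (\<lambda>j. a j - b j)" by (simp add: vec_eq_iff)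
      then show "x - y \<in> range of_int_vec" by simp
    qed
    fix c
    obtain y where y: "y \<in> X" using R(2) by blast
    obtain x where x: "x \<in> X" "dist (c + y) x \<le> R" using R(2)[of "c + y"] by auto
    have "x - y \<in> ?D \<inter> cball c R"
      using x y by (auto simp: dist_norm diff_diff_eq2)
    then show "?D \<inter> cball c R \<noteq> {}" by blast
  qed
qed

lemma patch_translate:
  assumes "\<And>z. z \<in> cball y T \<Longrightarrow> z \<in> X \<longleftrightarrow> z + v \<in> X"
  shows "patch X T (y + v) = patch X T y"
proof (intro set_eqI)
  fix p
  have "p \<in> patch X T w \<longleftrightarrow> p + w \<in> X \<and> norm p \<le> T" for w
    by (force simp: patch_def dist_norm norm_minus_commute)
  then show "p \<in> patch X T (y + v) \<longleftrightarrow> p \<in> patch X T y"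
    using assms[of "p + y"] by (auto simp: dist_norm algebra_simps)
qed

section \<open>Hierarchical two-colourings\<close>

text \<open>The \<open>pat i\<close> run through all colourings of a 2 x ... x 2 array;
  \<open>m_ge\<close> leaves room for \<open>N\<close> such arrays along the diagonal of a parent
  cell.\<close>

locale block_substitution =
  fixes m :: "nat \<Rightarrow> int" and pat :: "nat \<Rightarrow> ('n::finite \<Rightarrow> bool) \<Rightarrow> bool" and N :: nat
  assumes pat_onto: "\<exists>i<N. pat i = p"
    and m_ge: "2 * int N \<le> m k"
begin

section \<open>Place values, digits and colours\<close>

lemma N_pos: "N > 0"
  using pat_onto by fastforce

lemma m_ge_2: "m k \<ge> 2"
  using m_ge[of k] N_pos by linarith

definition L :: "nat \<Rightarrow> int" where
  "L k = (\<Prod>j<k. m j)"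

lemma L_0 [simp]: "L 0 = 1" and L_Suc: "L (Suc k) = L k * m k"
  by (simp_all add: L_def)

lemma L_pos: "L k > 0"
  unfolding L_def using m_ge_2 by (intro prod_pos) (meson less_le_trans zero_less_numeral)

lemma L_ge: "L k \<ge> 2 ^ k"
proof (induction k)
  case (Suc k)
  then have "2 ^ k * 2 \<le> L k * m k" using m_ge_2 L_pos by (intro mult_mono) (auto simp: less_imp_le)
  then show ?case by (simp add: L_Suc mult.commute)
qed simp

lemma L_dvd: "j \<le> k \<Longrightarrow> L j dvd L k"
  by (induction rule: dec_induct) (auto simp: L_Suc)

text \<open>Mixed-radix digits with place values \<open>L k\<close>: the position of a
  level-\<open>k\<close> cell within its parent. As \<open>div\<close> rounds down, negative
  coordinates fall into half-open cells of the same shape.\<close>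

definition digit :: "nat \<Rightarrow> ('n \<Rightarrow> int) \<Rightarrow> 'n \<Rightarrow> int" where
  "digit k x = (\<lambda>j. x j div L k mod m k)"

definition cell :: "nat \<Rightarrow> ('n \<Rightarrow> int) \<Rightarrow> 'n \<Rightarrow> int" where
  "cell k x = (\<lambda>j. x j div L k)"

text \<open>The whole box of \<open>(2 * N) ^ CARD('n)\<close> cells counts as the corner region,
  not only the 2 x ... x 2 arrays on its diagonal. Its number of cells is the same at every
  level.\<close>

definition marked :: "('n \<Rightarrow> int) \<Rightarrow> bool" where
  "marked d \<longleftrightarrow> (\<forall>j. d j \<in> {0..<2 * int N})"

text \<open>The \<open>i\<close>-th pattern on a \<open>2 \<times> \<dots> \<times> 2\<close> cube sits with its corner at \<open>(2i, \<dots>, 2i)\<close>, so that any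
  one coordinate, here the arbitrary \<open>undefined\<close>, determines \<open>i\<close>.\<close>

definition universal :: "('n \<Rightarrow> int) \<Rightarrow> bool" where
  "universal d = pat (nat (d undefined div 2)) (\<lambda>j. odd (d j))"

text \<open>The colour of the level-\<open>k\<close> cell of \<open>x\<close>: it is inherited from the parent cell unless the digit at
  level \<open>k\<close> is marked.\<close>

definition colour :: "nat \<Rightarrow> ('n \<Rightarrow> int) \<Rightarrow> bool" where
  "colour k x = (if \<exists>j\<ge>k. marked (digit j x)
     then universal (digit (LEAST j. j \<ge> k \<and> marked (digit j x)) x) else True)"

lemma colour_marked: "marked (digit k x) \<Longrightarrow> colour k x = universal (digit k x)"
proof -
  assume a: "marked (digit k x)"
  then have "(LEAST j. j \<ge> k \<and> marked (digit j x)) = k" by (intro Least_equality) auto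
  then show ?thesis using a by (auto simp: colour_def)
qed

text \<open>Leaving out the unmarked level \<open>k\<close> does not change the least marked level.
  If there is none, as can happen at points with a negative coordinate, both colours are the default
  \<open>True\<close>.\<close>

lemma colour_unmarked:
  assumes "\<not> marked (digit k x)"
  shows "colour k x = colour (Suc k) x"
proof -
  have "(j \<ge> k \<and> marked (digit j x)) = (j \<ge> Suc k \<and> marked (digit j x))" for j
    using assms by (metis Suc_leD not_less_eq_eq le_antisym)
  then show ?thesis unfolding colour_def by (simp only:)
qed

lemma cell_Suc: "cell (Suc k) x j = cell k x j div m k"
  using m_ge_2[of k] by (simp add: cell_def L_Suc zdiv_zmult2_eq)

lemma digit_cell: "digit k x j = cell k x j mod m k"
  by (simp add: digit_def cell_def)

lemma cell_eq_mono: "cell k x = cell k y \<Longrightarrow> k \<le> j \<Longrightarrow> cell j x = cell j y"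
  by (rotate_tac, induction rule: dec_induct) (auto simp: cell_Suc)

text \<open>The cell determines every digit from level \<open>k\<close> on, and the colour depends
  on nothing else.\<close>

lemma colour_cong:
  assumes "cell k x = cell k y"
  shows "colour k x = colour k y"
proof -
  have "digit j x = digit j y" if "j \<ge> k" for j
    using cell_eq_mono[OF assms that] by (auto simp: digit_cell)
  then have iff: "(j \<ge> k \<and> marked (digit j y)) = (j \<ge> k \<and> marked (digit j x))"
    and dig: "j \<ge> k \<and> marked (digit j x) \<Longrightarrow> universal (digit j y) = universal (digit j x)" for j
    by auto
  show ?thesis
    unfolding colour_def iff using dig[OF LeastI_ex[of "\<lambda>j. j \<ge> k \<and> marked (digit j x)"]] by auto
qed

text \<open>Since \<open>L (Suc i)\<close> divides \<open>L k\<close>, the translation changes the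
  quotient by \<open>L i\<close> by a multiple of \<open>m i\<close>.\<close>

lemma digit_translate:
  assumes "i < k"
  shows "digit i (\<lambda>j. x j + L k * v j) = digit i x"
proof
  fix j
  have "L i * m i dvd L k" using L_dvd[of "Suc i" k] assms by (simp add: L_Suc)
  then obtain r where r: "L k = L i * m i * r" by (elim dvdE)
  have "(x j + L k * v j) div L i = (x j + (m i * (r * v j)) * L i) div L i"
    by (simp add: r mult_ac)
  also have "\<dots> = m i * (r * v j) + x j div L i"
    using L_pos[of i] by (intro div_mult_self1) auto
  finally show "digit i (\<lambda>j. x j + L k * v j) j = digit i x j"
    by (simp add: digit_def)
qed

lemma cell_translate: "cell k (\<lambda>j. x j + L k * v j) j = cell k x j + v j"
  using L_pos[of k] by (simp add: cell_def)

text \<open>Downward induction over the levels: a marked digit below \<open>k\<close> survives the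
  translation and fixes the colour, and at an unmarked one the colour comes from the level
  above.\<close>

lemma colour_0_translate:
  assumes "colour k (\<lambda>j. x j + L k * v j) = colour k x"
  shows "colour 0 (\<lambda>j. x j + L k * v j) = colour 0 x"
proof -
  have "colour i (\<lambda>j. x j + L k * v j) = colour i x" if "i \<le> k" for i
    using that
  proof (induction rule: inc_induct)
    case base
    then show ?case by (rule assms)
  next
    case (step i)
    have d: "digit i (\<lambda>j. x j + L k * v j) = digit i x" using step by (intro digit_translate)
    show ?case
      by (cases "marked (digit i x)") (use d step in \<open>auto simp: colour_marked colour_unmarked\<close>)
  qed
  then show ?thesis by simp
qed

section \<open>Recurrence of patches and the repetitivity bound\<close>

lemma universal_pattern:
  assumes "i < N" "\<And>j. d j = 2 * int i + of_bool (e j)"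
  shows "marked d" "universal d = pat i e"
proof -
  show "marked d" unfolding marked_def using assms by (auto simp: of_bool_def)
  have "(\<lambda>j. odd (d j)) = e" using assms(2) by (auto simp: of_bool_def)
  moreover have "nat (d undefined div 2) = i" by (auto simp: assms(2))
  ultimately show "universal d = pat i e" by (simp add: universal_def)
qed

text \<open>A box of width \<open>2 * t\<close>, being less than \<open>L k\<close>, meets at most
  two level-\<open>k\<close> cells in each direction. Their colours form some pattern, and the
  translation takes them to the array showing that pattern in the level-\<open>Suc k\<close> cell of
  \<open>c\<close>.\<close>

lemma patch_recurs:
  fixes y c :: "'n \<Rightarrow> int"
  assumes t: "t \<ge> 0" "2 * t < L k"
  obtains v where
    "\<And>w. (\<And>j. \<bar>w j - y j\<bar> \<le> t) \<Longrightarrow> colour 0 (\<lambda>j. w j + L k * v j) = colour 0 w"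
    "cell (Suc k) (\<lambda>j. y j + L k * v j) = cell (Suc k) c"
proof -
  define z where "z j = (y j - t) div L k" for j
  define p where "p e = colour k (\<lambda>j. (z j + of_bool (e j)) * L k)" for e
  obtain i where i: "i < N" "pat i = p" using pat_onto by blast
  define Z where "Z = cell (Suc k) c"
  \<comment> \<open>Moves the lowest cell \<open>z\<close> to position (2i, ..., 2i) in the parent
    cell \<open>Z\<close>.\<close>
  define v where "v j = Z j * m k + 2 * int i - z j" for j
  have key: "colour 0 (\<lambda>j. w j + L k * v j) = colour 0 w
     \<and> cell (Suc k) (\<lambda>j. w j + L k * v j) = Z" if w: "\<And>j. \<bar>w j - y j\<bar> \<le> t" for w
  proof -
    have "z j \<le> cell k w j \<and> cell k w j \<le> z j + 1" for j
    proof
      have "y j - t \<le> w j" using w[of j] by linarith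
      then show "z j \<le> cell k w j" unfolding z_def cell_def using L_pos[of k] by (intro zdiv_mono1)
      have "w j \<le> (y j - t) + 1 * L k" using w[of j] t by linarith
      then have "cell k w j \<le> ((y j - t) + 1 * L k) div L k"
        unfolding cell_def using L_pos[of k] by (intro zdiv_mono1)
      also have "\<dots> = z j + 1" using L_pos[of k] by (simp add: z_def)
      finally show "cell k w j \<le> z j + 1" .
    qed
    then have ex: "cell k w j = z j + of_bool (cell k w j = z j + 1)" for j
      by (smt (verit) of_bool_eq)
    define e where "e j \<longleftrightarrow> cell k w j = z j + 1" for j
    have e: "cell k w j = z j + of_bool (e j)" for j unfolding e_def by (rule ex)
    have "colour k w = p e"
      unfolding p_def using L_pos[of k] by (intro colour_cong ext, subst e) (simp add: cell_def)
    let ?w = "\<lambda>j. w j + L k * v j"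
    \<comment> \<open>The array occupies positions \<open>2 * i\<close> and
      \<open>2 * i + 1\<close>, both below \<open>m k\<close>, so it does not spill over into a
      neighbouring parent cell.\<close>
    have b: "2 * int i + of_bool b \<in> {0..<m k}" for b
      using m_ge[of k] i(1) by (auto simp: of_bool_def)
    have c: "cell k ?w j = (2 * int i + of_bool (e j)) + Z j * m k" for j
      by (simp add: cell_translate e v_def)
    have d: "digit k ?w j = 2 * int i + of_bool (e j)" for j
      using b[of "e j"] unfolding digit_cell c by simp
    have "colour k ?w = p e"
      using universal_pattern[OF i(1) d] i(2) by (simp add: colour_marked)
    then have 1: "colour 0 ?w = colour 0 w"
      using \<open>colour k w = p e\<close> by (intro colour_0_translate) simp
    have "cell (Suc k) ?w j = Z j" for j
      using b[of "e j"] m_ge_2[of k] unfolding cell_Suc c by simp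
    then show ?thesis using 1 by blast
  qed
  show ?thesis
    by (rule that[of v]) (use key t in \<open>auto simp: Z_def\<close>)
qed

text \<open>Cells of level 0 are single points, so \<open>colour 0\<close> colours the lattice
  itself.\<close>

definition X :: "(real ^ 'n) set" where
  "X = of_int_vec ` {x. colour 0 x}"

lemma of_int_vec_in_X: "of_int_vec x \<in> X \<longleftrightarrow> colour 0 x"
  using inj_of_int_vec by (auto simp: X_def inj_def)

lemma X_nonempty: "X \<noteq> {}"
proof -
  obtain i where i: "i < N" "pat i = (\<lambda>_. True)" using pat_onto by blast
  define x :: "'n \<Rightarrow> int" where "x j = 2 * int i" for j
  have "digit 0 x j = 2 * int i + of_bool False" for j
    using i m_ge[of 0] by (simp add: digit_def x_def)
  from universal_pattern[OF i(1) this] i(2) have "colour 0 x" by (simp add: colour_marked)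
  then show ?thesis using of_int_vec_in_X[of x] by blast
qed

lemma dist_same_cell:
  assumes "cell k x = cell k (\<lambda>j. \<lfloor>c $ j\<rfloor>)"
  shows "dist c (of_int_vec x) \<le> real CARD('n) * of_int (L k)"
  unfolding dist_norm
proof (rule norm_le_card_mult)
  fix j
  let ?q = "x j div L k"
  have "\<lfloor>c $ j\<rfloor> div L k = ?q" using fun_cong[OF assms, of j] by (simp add: cell_def)
  then have "?q * L k \<le> \<lfloor>c $ j\<rfloor>" "\<lfloor>c $ j\<rfloor> < ?q * L k + L k"
    "?q * L k \<le> x j" "x j < ?q * L k + L k"
    using L_pos[of k] by (smt (verit) div_mult_mod_eq pos_mod_bound pos_mod_sign)+
  then have "\<bar>c $ j - of_int (x j)\<bar> \<le> of_int (L k)" by linarith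
  then show "\<bar>(c - of_int_vec x) $ j\<bar> \<le> of_int (L k)" by simp
qed

text \<open>\<open>patch_recurs\<close> puts a copy of the patch into the level-\<open>Suc k\<close>
  cell around \<open>c\<close>, and \<open>dist_same_cell\<close> bounds the distance from
  \<open>c\<close> to the lattice points of that cell.\<close>

lemma repetitivity_radius_X:
  assumes T: "T > 0" "2 * T < of_int (L k)"
  shows "repetitivity_radius X T (real CARD('n) * of_int (L (Suc k)))"
  unfolding repetitivity_radius_def
proof (intro conjI allI ballI)
  show "0 < real CARD('n) * of_int (L (Suc k))" using L_pos by simp
next
  fix c y :: "real ^ 'n" assume "y \<in> X"
  then obtain a where a: "y = of_int_vec a" "colour 0 a" by (auto simp: X_def)
  \<comment> \<open>Coordinates of lattice points differ by integers, so the radius may be rounded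
    down.\<close>
  have t: "\<lfloor>T\<rfloor> \<ge> 0" "2 * \<lfloor>T\<rfloor> < L k" using T by linarith+
  obtain v where v:
    "\<And>w. (\<And>j. \<bar>w j - a j\<bar> \<le> \<lfloor>T\<rfloor>) \<Longrightarrow> colour 0 (\<lambda>j. w j + L k * v j) = colour 0 w"
    "cell (Suc k) (\<lambda>j. a j + L k * v j) = cell (Suc k) (\<lambda>j. \<lfloor>c $ j\<rfloor>)"
    using patch_recurs[OF t, of a "\<lambda>j. \<lfloor>c $ j\<rfloor>"] by blast
  define s where "s = (of_int_vec (\<lambda>j. L k * v j) :: real ^ 'n)"
  have add: "of_int_vec w + s = of_int_vec (\<lambda>j. w j + L k * v j)" for w
    by (simp add: s_def vec_eq_iff)
  have eq: "z \<in> X \<longleftrightarrow> z + s \<in> X" if z: "z \<in> cball y T" for z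
  proof (cases "z \<in> range of_int_vec")
    case True
    then obtain w where w: "z = of_int_vec w" by blast
    have "\<bar>w j - a j\<bar> \<le> \<lfloor>T\<rfloor>" for j
    proof -
      have "\<bar>(z - y) $ j\<bar> \<le> T"
        using component_le_norm_cart[of "z - y" j] z by (simp add: dist_norm norm_minus_commute)
      then show ?thesis by (simp add: w a(1)) linarith
    qed
    then show ?thesis using v(1) by (simp add: w add of_int_vec_in_X)
  next
    case False
    have "z + s \<notin> X"
    proof
      assume "z + s \<in> X"
      then obtain w where "z + s = of_int_vec w" by (auto simp: X_def)
      then have "z = of_int_vec (\<lambda>j. w j - L k * v j)" by (simp add: s_def vec_eq_iff algebra_simps)
      then show False using False by blast
    qed
    moreover have "z \<notin> X" using False by (auto simp: X_def)
    ultimately show ?thesis by simp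
  qed
  show "\<exists>x\<in>X \<inter> cball c (real CARD('n) * of_int (L (Suc k))). patch X T x = patch X T y"
  proof (intro bexI IntI)
    show "patch X T (y + s) = patch X T y" using eq by (rule patch_translate)
    show "y + s \<in> X" using eq[of y] \<open>y \<in> X\<close> T by simp
    show "y + s \<in> cball c (real CARD('n) * of_int (L (Suc k)))"
      using dist_same_cell[OF v(2)] by (simp add: a(1) add)
  qed
qed

lemma ex_L_gt: "\<exists>k. (T :: real) < of_int (L k)"
proof -
  obtain k where "T < 2 ^ k" using real_arch_pow[of 2 T] by auto
  also have "\<dots> \<le> of_int (L k)" using L_ge[of k] by (metis of_int_le_iff of_int_numeral of_int_power)
  finally show ?thesis by blast
qed

lemma repetitive_X: "repetitive X"
  unfolding repetitive_def using repetitivity_radius_X ex_L_gt by blast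

text \<open>Repetitivity for a single patch radius already gives relative density.\<close>

lemma meyer_X: "meyer_set X"
proof -
  obtain M where M: "repetitivity_radius X 1 M" using repetitive_X unfolding repetitive_def by force
  show ?thesis
  proof (rule meyer_set_of_int_vec)
    show "X \<subseteq> range of_int_vec" by (auto simp: X_def)
    show "M > 0" using M by (simp add: repetitivity_radius_def)
    show "X \<inter> cball c M \<noteq> {}" for c
      using M X_nonempty unfolding repetitivity_radius_def by blast
  qed
qed

lemma repetitivity_function_X_le:
  assumes T: "T > 0" "2 * T < of_int (L k)"
  shows "0 < repetitivity_function X T"
    and "repetitivity_function X T \<le> real CARD('n) * of_int (L (Suc k))"
  using repetitivity_function_least[of X T] meyer_X repetitive_X T repetitivity_radius_X[OF T]
  by (auto simp: meyer_set_def repetitivity_radius_def)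

section \<open>Points that deviate from the colour of their cell\<close>

lemma colour_deviates:
  "colour 0 x \<noteq> colour k x \<Longrightarrow> \<exists>i<k. marked (digit i x)"
proof (induction k)
  case (Suc k)
  then show ?case using colour_unmarked[of k x] by (metis less_Suc_eq)
qed simp

lemma finite_cell: "finite {x. cell k x = z}"
  and card_cell: "real (card {x. cell k x = z}) = of_int (L k) ^ CARD('n)"
proof -
  have "cell k x = z \<longleftrightarrow> (\<forall>j. x j \<in> {z j * L k..<z j * L k + L k})" for x
  proof -
    have "x j div L k = z j \<longleftrightarrow> x j \<in> {z j * L k..<z j * L k + L k}" for j
    proof
      assume "x j div L k = z j"
      then show "x j \<in> {z j * L k..<z j * L k + L k}"
        using L_pos[of k] by (smt (verit) atLeastLessThan_iff div_mult_mod_eq pos_mod_bound pos_mod_sign)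
    next
      assume "x j \<in> {z j * L k..<z j * L k + L k}"
      then show "x j div L k = z j"
        by (intro int_div_pos_eq[where r = "x j - z j * L k"]) (auto simp: mult.commute)
    qed
    then show ?thesis by (auto simp: cell_def)
  qed
  then have eq: "{x. cell k x = z} = {x. \<forall>j. x j \<in> {z j * L k..<z j * L k + L k}}" by auto
  show "finite {x. cell k x = z}" unfolding eq by (intro finite_box_fun) auto
  show "real (card {x. cell k x = z}) = of_int (L k) ^ CARD('n)"
    unfolding eq using L_pos[of k] by (subst finite_box_fun) (auto simp: less_imp_le)
qed

text \<open>By \<open>colour_deviates\<close> this contains every point of the cell whose colour
  differs from that of the cell. A condition on digits alone can be counted level by level.\<close>

definition deviating :: "nat \<Rightarrow> ('n \<Rightarrow> int) \<Rightarrow> ('n \<Rightarrow> int) set" where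
  "deviating k z = {x. cell k x = z \<and> (\<exists>i<k. marked (digit i x))}"

lemma finite_deviating: "finite (deviating k z)"
  by (rule finite_subset[OF _ finite_cell[of k z]]) (auto simp: deviating_def)

lemma finite_marked: "finite {d. marked d}"
  and card_marked: "card {d. marked d} = (2 * N) ^ CARD('n)"
proof -
  show "finite {d. marked d}" unfolding marked_def by (intro finite_box_fun) auto
  show "card {d. marked d} = (2 * N) ^ CARD('n)"
    unfolding marked_def by (subst finite_box_fun) (auto simp: nat_mult_distrib)
qed

text \<open>A union bound over the levels. In the induction step either the level-\<open>k\<close>
  digit is marked, which costs a whole subcell for each marked digit, or the point already deviates
  within one of the \<open>m k ^ CARD('n)\<close> subcells.\<close>

lemma card_deviating:
  "real (card (deviating k z))
     \<le> of_int (L k) ^ CARD('n) * (\<Sum>i<k. real (2 * N) ^ CARD('n) / of_int (m i) ^ CARD('n))"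
proof (induction k arbitrary: z)
  case 0
  then show ?case by (simp add: deviating_def)
next
  case (Suc k)
  define D where "D = {d :: 'n \<Rightarrow> int. \<forall>j. d j \<in> {0..<m k}}"
  have D: "finite D" "real (card D) = of_int (m k) ^ CARD('n)"
    unfolding D_def using m_ge_2[of k] by (simp_all only: finite_box_fun finite_atLeastLessThan_int) simp
  define sub where "sub d = (\<lambda>j. z j * m k + d j)" for d
  have cov: "\<exists>d\<in>D. d = digit k x \<and> cell k x = sub d" if "cell (Suc k) x = z" for x
  proof -
    have "digit k x \<in> D" using m_ge_2[of k] by (auto simp: D_def digit_cell intro!: pos_mod_bound)
    moreover have "cell k x j = sub (digit k x) j" for j
      using fun_cong[OF that, of j] by (simp add: sub_def digit_cell cell_Suc flip: \<open>cell (Suc k) x = z\<close>)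
    ultimately show ?thesis by blast
  qed
  have "deviating (Suc k) z \<subseteq> (\<Union>d\<in>{d. marked d}. {x. cell k x = sub d}) \<union> (\<Union>d\<in>D. deviating k (sub d))"
  proof
    fix x assume x: "x \<in> deviating (Suc k) z"
    then obtain d where d: "d \<in> D" "d = digit k x" "cell k x = sub d"
      using cov[of x] by (auto simp: deviating_def)
    show "x \<in> (\<Union>d\<in>{d. marked d}. {x. cell k x = sub d}) \<union> (\<Union>d\<in>D. deviating k (sub d))"
      using x d by (cases "marked (digit k x)") (auto simp: deviating_def less_Suc_eq)
  qed
  then have "card (deviating (Suc k) z)
     \<le> card ((\<Union>d\<in>{d. marked d}. {x. cell k x = sub d}) \<union> (\<Union>d\<in>D. deviating k (sub d)))"
    using finite_marked finite_cell D(1) finite_deviating by (intro card_mono) auto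
  also have "\<dots> \<le> card (\<Union>d\<in>{d. marked d}. {x. cell k x = sub d}) + card (\<Union>d\<in>D. deviating k (sub d))"
    by (rule card_Un_le)
  also have "\<dots> \<le> (\<Sum>d\<in>{d. marked d}. card {x. cell k x = sub d}) + (\<Sum>d\<in>D. card (deviating k (sub d)))"
    by (intro add_mono card_UN_le finite_marked D(1))
  finally have "real (card (deviating (Suc k) z))
     \<le> (\<Sum>d\<in>{d. marked d}. real (card {x. cell k x = sub d})) + (\<Sum>d\<in>D. real (card (deviating k (sub d))))"
    by (metis (mono_tags, lifting) of_nat_add of_nat_le_iff of_nat_sum sum.cong)
  also have "\<dots> \<le> real (2 * N) ^ CARD('n) * of_int (L k) ^ CARD('n)
      + of_int (m k) ^ CARD('n) * (of_int (L k) ^ CARD('n) * (\<Sum>i<k. real (2 * N) ^ CARD('n) / of_int (m i) ^ CARD('n)))"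
    using sum_mono[of D "\<lambda>d. real (card (deviating k (sub d)))", OF Suc.IH] D(2)
    by (simp add: card_cell card_marked)
  also have "\<dots> = of_int (L (Suc k)) ^ CARD('n) * (\<Sum>i<Suc k. real (2 * N) ^ CARD('n) / of_int (m i) ^ CARD('n))"
    using m_ge_2[of k] by (simp add: L_Suc power_mult_distrib algebra_simps)
  finally show ?case .
qed

section \<open>Unequal densities in large balls\<close>

lemma ex_cell_colour: "\<exists>z. \<forall>x. cell k x = z \<longrightarrow> colour k x = b"
proof -
  \<comment> \<open>Constant patterns are among the \<open>pat i\<close>, so both colours occur at
    every level; the cell (2i, ..., 2i) has itself as digit.\<close>
  obtain i where i: "i < N" "pat i = (\<lambda>_. b)" using pat_onto by blast
  have "colour k x = b" if "cell k x = (\<lambda>j. 2 * int i)" for x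
  proof -
    have "digit k x j = 2 * int i + of_bool False" for j
      using i m_ge[of k] by (simp add: digit_cell that)
    from universal_pattern[OF i(1) this] i(2) show ?thesis by (simp add: colour_marked)
  qed
  then show ?thesis by blast
qed

text \<open>Distinct lattice points are at least 1 apart, so all patches of radius 1/2 are trivial
  and their frequency is the density of \<open>X\<close>.\<close>

lemma patch_count_half: "patch_count X (1/2) {0} D = card (X \<inter> D)"
proof -
  have "patch X (1/2) x = {0}" if "x \<in> X" for x
  proof -
    have "z = x" if "z \<in> X" "dist x z \<le> 1/2" for z
    proof -
      obtain a b where ab: "x = of_int_vec a" "z = of_int_vec b"
        using \<open>x \<in> X\<close> \<open>z \<in> X\<close> by (auto simp: X_def)
      show ?thesis using of_int_vec_dist_ge_1[of a b] that(2) unfolding ab by fastforce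
    qed
    then have "X \<inter> cball x (1/2) = {x}" using \<open>x \<in> X\<close> by auto
    then show ?thesis by (simp add: patch_def)
  qed
  then have "{x \<in> X \<inter> D. patch X (1/2) x = {0}} = X \<inter> D" by auto
  then show ?thesis by (simp add: patch_count_def)
qed

text \<open>The radius falls short of half the side of a cell by \<open>1/2\<close>, so that a suitably centred closed
  ball contains lattice points of only one half-open cell.\<close>

lemma inscribed_ball_counts:
  fixes \<epsilon> :: real
  assumes eps: "(\<Sum>i<k. real (2 * N) ^ CARD('n) / of_int (m i) ^ CARD('n)) \<le> \<epsilon>"
    and U: "U = (of_int (L k) - 1) / 2" "U \<ge> real CARD('n)"
  obtains s t :: "real ^ 'n" where
    "(U / CARD('n)) ^ CARD('n) - \<epsilon> * of_int (L k) ^ CARD('n) \<le> real (card (X \<inter> cball s U))"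
    "real (card (X \<inter> cball t U)) \<le> \<epsilon> * of_int (L k) ^ CARD('n)"
proof -
  \<comment> \<open>The midpoint of the lattice points of the cell, whose coordinates run from
    \<open>z j * L k\<close> to \<open>z j * L k + L k - 1\<close>.\<close>
  define c where "c z = (\<chi> j. of_int (z j) * of_int (L k) + U)" for z :: "'n \<Rightarrow> int"
  have n: "real CARD('n) \<ge> 1" by (simp add: Suc_leI)
  have dev: "real (card (deviating k z)) \<le> \<epsilon> * of_int (L k) ^ CARD('n)" for z
  proof -
    have "of_int (L k) ^ CARD('n) * (\<Sum>i<k. real (2 * N) ^ CARD('n) / of_int (m i) ^ CARD('n))
        \<le> of_int (L k) ^ CARD('n) * \<epsilon>"
      using eps L_pos[of k] by (intro mult_left_mono) auto
    then show ?thesis using card_deviating[of k z] by (simp add: mult.commute)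
  qed
  have in_cell: "cell k w = z" if "of_int_vec w \<in> cball (c z) U" for w z
  proof
    fix j
    have "\<bar>(of_int_vec w - c z) $ j\<bar> \<le> U"
      using component_le_norm_cart[of "of_int_vec w - c z" j] that
      by (simp add: dist_norm norm_minus_commute)
    then have "\<bar>of_int (w j) - (of_int (z j) * of_int (L k) + U)\<bar> \<le> U" by (simp add: c_def)
    then have "real_of_int (z j * L k) \<le> of_int (w j)"
      "real_of_int (w j) \<le> real_of_int (z j * L k + L k - 1)"
      unfolding U(1) by (simp_all add: field_simps abs_le_iff)
    then have "z j * L k \<le> w j" "w j \<le> z j * L k + L k - 1" by (simp_all only: of_int_le_iff)
    then show "cell k w j = z j" unfolding cell_def
      by (intro int_div_pos_eq[where r = "w j - z j * L k"]) (auto simp: mult.commute)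
  qed
  have fin: "finite (X \<inter> cball t U)" for t
    using meyer_X by (intro delone_set_finite_Int_cball) (simp add: meyer_set_def)
  obtain z1 where z1: "\<And>x. cell k x = z1 \<Longrightarrow> colour k x = True" using ex_cell_colour by blast
  obtain z0 where z0: "\<And>x. cell k x = z0 \<Longrightarrow> colour k x = False" using ex_cell_colour by blast
  \<comment> \<open>In a cell of colour \<open>False\<close> only deviating points belong to
    \<open>X\<close>.\<close>
  have "X \<inter> cball (c z0) U \<subseteq> of_int_vec ` deviating k z0"
  proof
    fix p assume p: "p \<in> X \<inter> cball (c z0) U"
    then obtain w where w: "p = of_int_vec w" "colour 0 w" by (auto simp: X_def)
    then have "cell k w = z0" using p in_cell by auto
    then show "p \<in> of_int_vec ` deviating k z0"
      using w z0 colour_deviates[of w k] by (auto simp: deviating_def)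
  qed
  then have "card (X \<inter> cball (c z0) U) \<le> card (deviating k z0)"
    using finite_deviating surj_card_le by blast
  then have 0: "real (card (X \<inter> cball (c z0) U)) \<le> \<epsilon> * of_int (L k) ^ CARD('n)"
    using dev[of z0] by linarith
  \<comment> \<open>By the l1 bound on the norm, the cube of half-side \<open>r\<close> lies in the
    ball of radius \<open>U\<close>.\<close>
  define r where "r = U / CARD('n)"
  have r: "r \<ge> 1" using U n by (simp add: r_def field_simps)
  define B where "B = {w. \<forall>j. w j \<in> {\<lceil>c z1 $ j - r\<rceil>..\<lfloor>c z1 $ j + r\<rfloor>}}"
  have "r ^ CARD('n) = (\<Prod>j\<in>(UNIV :: 'n set). r)" by simp
  also have "\<dots> \<le> (\<Prod>j\<in>UNIV. real (card {\<lceil>c z1 $ j - r\<rceil>..\<lfloor>c z1 $ j + r\<rfloor>}))"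
  proof (rule prod_mono)
    fix j
    \<comment> \<open>An interval of length \<open>2 * r\<close> contains at least
      \<open>2 * r - 1\<close> integers, and \<open>r\<close> is at least 1.\<close>
    have "r \<le> real_of_int (\<lfloor>c z1 $ j + r\<rfloor> + 1 - \<lceil>c z1 $ j - r\<rceil>)" using r by linarith
    also have "\<dots> \<le> real (card {\<lceil>c z1 $ j - r\<rceil>..\<lfloor>c z1 $ j + r\<rfloor>})" by simp
    finally show "0 \<le> r \<and> r \<le> real (card {\<lceil>c z1 $ j - r\<rceil>..\<lfloor>c z1 $ j + r\<rfloor>})" using r by simp
  qed
  also have "\<dots> = real (card B)"
    unfolding B_def by (subst finite_box_fun) auto
  finally have cardB: "r ^ CARD('n) \<le> real (card B)" .
  have "of_int_vec ` (B - deviating k z1) \<subseteq> X \<inter> cball (c z1) U"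
  proof
    fix p assume "p \<in> of_int_vec ` (B - deviating k z1)"
    then obtain w where w: "p = of_int_vec w" "w \<in> B" "w \<notin> deviating k z1" by blast
    have "norm (c z1 - of_int_vec w) \<le> real CARD('n) * r"
    proof (rule norm_le_card_mult)
      fix j
      have "w j \<in> {\<lceil>c z1 $ j - r\<rceil>..\<lfloor>c z1 $ j + r\<rfloor>}" using w(2) by (simp add: B_def)
      then have "\<bar>c z1 $ j - of_int (w j)\<bar> \<le> r" unfolding atLeastAtMost_iff by linarith
      then show "\<bar>(c z1 - of_int_vec w) $ j\<bar> \<le> r" by simp
    qed
    then have ball: "of_int_vec w \<in> cball (c z1) U" by (simp add: r_def dist_norm)
    then have "colour 0 w"
      using w(3) in_cell z1 colour_deviates[of w k] by (auto simp: deviating_def)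
    then show "p \<in> X \<inter> cball (c z1) U" using w(1) ball of_int_vec_in_X by blast
  qed
  then have "card (of_int_vec ` (B - deviating k z1)) \<le> card (X \<inter> cball (c z1) U)"
    by (intro card_mono fin)
  also have "card (of_int_vec ` (B - deviating k z1)) = card (B - deviating k z1)"
    by (intro card_image inj_on_subset[OF inj_of_int_vec]) simp
  finally have "card B - card (deviating k z1) \<le> card (X \<inter> cball (c z1) U)"
    using diff_card_le_card_Diff[OF finite_deviating, of B k z1] by linarith
  then have "real (card B) - real (card (deviating k z1)) \<le> real (card (X \<inter> cball (c z1) U))"
    by linarith
  then have 1: "r ^ CARD('n) - \<epsilon> * of_int (L k) ^ CARD('n) \<le> real (card (X \<inter> cball (c z1) U))"
    using cardB dev[of z1] by linarith
  show ?thesis using that[OF 1[unfolded r_def] 0] .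
qed

text \<open>Arbitrarily large balls of equal radius inside cells of the two colours have densities a
  fixed gap apart, so they cannot both approach one frequency.\<close>

lemma not_uniform_patch_frequencies_X:
  assumes eps: "\<And>k. (\<Sum>i<k. real (2 * N) ^ CARD('n) / of_int (m i) ^ CARD('n))
     \<le> 1 / (4 * (4 * real CARD('n)) ^ CARD('n))"
  shows "\<not> uniform_patch_frequencies X"
proof
  assume upf: "uniform_patch_frequencies X"
  let ?n = "CARD('n)"
  define \<kappa> where "\<kappa> = measure lborel (cball (0 :: real ^ 'n) 1)"
  have \<kappa>: "\<kappa> > 0" unfolding \<kappa>_def by (simp add: content_cball_pos)
  obtain x where "x \<in> X" using X_nonempty by blast
  moreover have "patch X (1/2) x = {0}"
  proof -
    have "card (X \<inter> {x}) = 1" using \<open>x \<in> X\<close> by simp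
    then have "card {y \<in> X \<inter> {x}. patch X (1/2) y = {0}} \<noteq> 0"
      using patch_count_half[of "{x}"] by (simp add: patch_count_def)
    then have "{y \<in> X \<inter> {x}. patch X (1/2) y = {0}} \<noteq> {}" by (metis card.empty)
    then show ?thesis by blast
  qed
  ultimately have P: "{0} \<in> patch X (1/2) ` X" by (metis image_eqI)
  have "\<exists>f. uniform_limit UNIV (\<lambda>U t. real (patch_count X (1/2) {0} (cball t U)) / (\<kappa> * U ^ ?n))
      (\<lambda>t. f) at_top"
    using upf[unfolded uniform_patch_frequencies_def, rule_format, OF _ P] by (simp add: \<kappa>_def)
  then obtain f where f: "uniform_limit UNIV
      (\<lambda>U t. real (card (X \<inter> cball t U)) / (\<kappa> * U ^ ?n)) (\<lambda>t. f) at_top"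
    unfolding patch_count_half by blast
  \<comment> \<open>Half of the gap between the two normalised counts compared at the end.\<close>
  define e where "e = 1 / (4 * real ?n ^ ?n * \<kappa>)"
  have e: "e > 0" using \<kappa> by (simp add: e_def)
  obtain U0 where U0: "\<And>U t. U \<ge> U0 \<Longrightarrow> \<bar>real (card (X \<inter> cball t U)) / (\<kappa> * U ^ ?n) - f\<bar> < e"
    using uniform_limitD[OF f e] by (auto simp: eventually_at_top_linorder dist_real_def)
  obtain k where k: "2 * max U0 ?n + 1 < of_int (L k)" using ex_L_gt by blast
  define U where "U = (real_of_int (L k) - 1) / 2"
  have U: "U \<ge> U0" "U \<ge> ?n" using k by (auto simp: U_def max_def split: if_splits)
  have n: "real ?n \<ge> 1" by (simp add: Suc_leI)
  then have U1: "1 \<le> U" using U(2) by (rule order_trans)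
  define \<epsilon> where "\<epsilon> = 1 / (4 * (4 * real ?n) ^ ?n)"
  obtain s t where st:
    "(U / ?n) ^ ?n - \<epsilon> * of_int (L k) ^ ?n \<le> real (card (X \<inter> cball s U))"
    "real (card (X \<inter> cball t U)) \<le> \<epsilon> * of_int (L k) ^ ?n"
    using inscribed_ball_counts[OF eps[folded \<epsilon>_def] U_def U(2)] by blast
  have "real_of_int (L k) ^ ?n \<le> (4 * U) ^ ?n"
  proof (rule power_mono)
    have "real_of_int (L k) = 2 * U + 1" by (simp add: U_def field_simps)
    then show "real_of_int (L k) \<le> 4 * U" using U1 by linarith
  qed (use L_pos[of k] in simp)
  then have "\<epsilon> * of_int (L k) ^ ?n \<le> \<epsilon> * (4 * U) ^ ?n"
    by (intro mult_left_mono) (auto simp: \<epsilon>_def)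
  also have "\<dots> = (U / ?n) ^ ?n / 4"
    using n by (simp add: \<epsilon>_def power_mult_distrib power_divide)
  finally have "(U / ?n) ^ ?n / 2 \<le> real (card (X \<inter> cball s U)) - real (card (X \<inter> cball t U))"
    using st by linarith
  moreover have "\<kappa> * U ^ ?n > 0" using \<kappa> U1 by simp
  ultimately have "((U / ?n) ^ ?n / 2) / (\<kappa> * U ^ ?n)
     \<le> real (card (X \<inter> cball s U)) / (\<kappa> * U ^ ?n) - real (card (X \<inter> cball t U)) / (\<kappa> * U ^ ?n)"
    unfolding diff_divide_distrib[symmetric] by (intro divide_right_mono) auto
  moreover have "((U / ?n) ^ ?n / 2) / (\<kappa> * U ^ ?n) = 2 * e"
    using U1 n \<kappa> by (simp add: e_def power_divide field_simps)
  ultimately show False using U0[OF U(1), of s] U0[OF U(1), of t] by linarith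
qed

end

section \<open>The block sizes\<close>

text \<open>The shift by \<open>27 \<ge> exp (exp 1)\<close> makes the iterated logarithm at least \<open>1\<close>.\<close>

definition growth :: "nat \<Rightarrow> real" where
  "growth k = real (k + 27) * ln (real (k + 27)) * (ln (ln (real (k + 27))))\<^sup>2"

lemma ln_ln_ge_1: "x \<ge> 27 \<Longrightarrow> ln x \<ge> 1 \<and> ln (ln x) \<ge> (1::real)"
proof -
  assume x: "x \<ge> 27"
  have "exp (exp 1) \<le> exp (3::real)" using exp_le by simp
  also have "\<dots> = exp 1 ^ 3" using exp_of_nat_mult[of 3 "1::real"] by simp
  also have "\<dots> \<le> 3 ^ 3" using exp_le by (intro power_mono) auto
  also have "\<dots> \<le> x" using x by simp
  finally have "exp 1 \<le> ln x" using x by (simp add: ln_ge_iff)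
  moreover have "exp 1 \<ge> (1::real)" by simp
  ultimately show ?thesis by (meson dual_order.trans less_le_trans ln_ge_iff zero_less_one exp_gt_zero)
qed

lemma growth_ge: "real (k + 27) \<le> growth k"
proof -
  have "1 \<le> ln (real (k + 27))" "1 \<le> (ln (ln (real (k + 27))))\<^sup>2"
    using ln_ln_ge_1[of "real (k + 27)"] by (auto intro: one_le_power)
  then have "real (k + 27) * 1 * 1 \<le> growth k"
    unfolding growth_def by (intro mult_mono) auto
  then show ?thesis by simp
qed

lemma growth_mono: "growth k \<le> growth (Suc k)"
proof -
  have "1 \<le> ln (real (k + 27))" "1 \<le> ln (ln (real (k + 27)))"
    using ln_ln_ge_1[of "real (k + 27)"] by auto
  then show ?thesis unfolding growth_def
    by (intro mult_mono power_mono) (auto simp: ln_mono)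
qed

text \<open>The terms are dominated by the differences of \<open>- 1 / ln (ln x)\<close>, whose derivative is
  \<open>1 / (x * ln x * (ln (ln x))\<^sup>2)\<close>.\<close>

lemma sum_inverse_growth: "(\<Sum>j<k. 1 / growth j) \<le> 2"
proof -
  define h where "h j = ln (ln (real (j + 27)))" for j :: nat
  have h: "h j \<ge> 1" for j using ln_ln_ge_1[of "real (j + 27)"] by (simp add: h_def)
  have step: "1 / growth (Suc j) \<le> 1 / h j - 1 / h (Suc j)" for j
  proof -
    define x where "x = real (j + 27)"
    have x: "x \<ge> 27" "ln x \<ge> 1" "ln (x + 1) \<ge> 1"
      using ln_ln_ge_1[of x] ln_ln_ge_1[of "x + 1"] by (auto simp: x_def)
    have hx: "h j = ln (ln x)" "h (Suc j) = ln (ln (x + 1))" by (simp_all add: h_def x_def add_ac)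
    \<comment> \<open>The bound ln y \<le> y - 1, used once for each of the two nested logarithms,
      serves as a discrete mean value estimate.\<close>
    have "ln (x / (x + 1)) \<le> x / (x + 1) - 1" using x by (intro ln_le_minus_one) auto
    then have 1: "1 / (x + 1) \<le> ln (x + 1) - ln x" using x by (simp add: ln_div field_simps)
    have "ln (ln x / ln (x + 1)) \<le> ln x / ln (x + 1) - 1" using x by (intro ln_le_minus_one) auto
    then have "(ln (x + 1) - ln x) / ln (x + 1) \<le> ln (ln (x + 1)) - ln (ln x)"
      using x by (simp add: ln_div diff_divide_distrib)
    moreover have "(1 / (x + 1)) / ln (x + 1) \<le> (ln (x + 1) - ln x) / ln (x + 1)"
      using 1 x by (intro divide_right_mono) auto
    ultimately have 2: "1 / ((x + 1) * ln (x + 1)) \<le> h (Suc j) - h j" by (simp add: hx)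
    then have "h j \<le> h (Suc j)" using x by (smt (verit) divide_nonneg_nonneg mult_nonneg_nonneg)
    \<comment> \<open>Lowering one factor of the denominator to \<open>h j\<close> produces a
      telescoping difference.\<close>
    then have "(h (Suc j) - h j) / (h (Suc j) * h (Suc j)) \<le> (h (Suc j) - h j) / (h j * h (Suc j))"
      using h[of j] h[of "Suc j"] by (intro divide_left_mono mult_right_mono mult_pos_pos) auto
    also have "\<dots> = 1 / h j - 1 / h (Suc j)"
      using h[of j] h[of "Suc j"] by (simp add: field_simps)
    finally have 3: "(h (Suc j) - h j) / (h (Suc j) * h (Suc j)) \<le> 1 / h j - 1 / h (Suc j)" .
    have "1 / growth (Suc j) = 1 / ((x + 1) * ln (x + 1)) / (h (Suc j) * h (Suc j))"
      by (simp add: growth_def hx x_def power2_eq_square add_ac)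
    also have "\<dots> \<le> (h (Suc j) - h j) / (h (Suc j) * h (Suc j))"
      using 2 by (intro divide_right_mono) auto
    finally show ?thesis using 3 by linarith
  qed
  have "(\<Sum>j<Suc k. 1 / growth j) \<le> 2 - 1 / h k" for k
  proof (induction k)
    case 0
    have "1 / growth 0 \<le> 1/27" using growth_ge[of 0] by (simp add: field_simps)
    moreover have "1 / h 0 \<le> 1" using h[of 0] by simp
    ultimately show ?case by simp
  next
    case (Suc k)
    then show ?case using step[of k] by simp
  qed
  then have "(\<Sum>j<Suc k. 1 / growth j) \<le> 2"
    using h[of k] by (smt (verit) divide_nonneg_nonneg)
  moreover have "growth k \<ge> 0" using growth_ge[of k] by linarith
  then have "1 / growth k \<ge> 0" by simp
  ultimately show ?thesis unfolding sum.lessThan_Suc by linarith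
qed

text \<open>A weak Stirling bound, from which \<open>ln (L p)\<close> grows at least like p ln p /
  n.\<close>

lemma sum_ln_shift_ge: "(\<Sum>j<p. ln (real (j + 27))) \<ge> p * ln (real (p + 27)) - p"
proof (induction p)
  case (Suc p)
  define x where "x = real (p + 27)"
  have x: "x \<ge> 27" by (simp add: x_def)
  have "ln (1 + 1 / x) \<le> 1 / x" using x by (intro ln_add_one_self_le_self) auto
  moreover have "1 + 1 / x = (x + 1) / x" using x by (simp add: field_simps)
  then have "ln (1 + 1 / x) = ln (x + 1) - ln x" using x by (simp add: ln_div)
  ultimately have "ln (x + 1) - ln x \<le> 1 / x" by simp
  then have "(real p + 1) * (ln (x + 1) - ln x) \<le> (real p + 1) * (1 / x)"
    by (intro mult_left_mono) auto
  also have "\<dots> \<le> 1" by (simp add: x_def)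
  finally have "(real p + 1) * (ln (x + 1) - ln x) \<le> 1" .
  then have "(real p + 1) * ln (x + 1) - (real p + 1) \<le> p * ln x - p + ln x"
    by (simp add: algebra_simps)
  then show ?case using Suc by (simp add: x_def add_ac)
qed simp

text \<open>Halving the leading term absorbs the lower-order ones. The two bounds later give, for x
  = p + 28, both x ln x = O(ln T) and x \<le> ln T.\<close>

lemma eventually_ln_product_bound:
  assumes "n > 0"
  shows "\<forall>\<^sub>F p in sequentially.
    real (p + 28) * ln (real (p + 28)) / (2 * n) \<le> (p * ln (real (p + 27)) - p) / n - ln 2"
  and "\<forall>\<^sub>F p in sequentially. real (p + 28) \<le> real (p + 28) * ln (real (p + 28)) / (2 * n)"
  using assms by real_asymp+

section \<open>Choice of the block sizes and conclusion\<close>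

theorem corollary6p2:
  "\<exists>X :: (real ^ 'n::finite) set.
     meyer_set X \<and> repetitive X \<and>
     repetitivity_function X \<in>
       O[at_top](\<lambda>T. T * ln T powr (2 / real CARD('n))
                       * ln (ln (ln T)) powr (4 / real CARD('n))) \<and>
     \<not> uniform_patch_frequencies X"
proof -
  define n where "n = CARD('n)"
  have n: "n > 0" by (simp add: n_def)
  obtain pat :: "nat \<Rightarrow> ('n \<Rightarrow> bool) \<Rightarrow> bool" and N where
    pat: "(UNIV :: (('n \<Rightarrow> bool) \<Rightarrow> bool) set) = pat ` {i. i < N}"
    using finite_imp_nat_seg_image_inj_on[of "UNIV :: (('n \<Rightarrow> bool) \<Rightarrow> bool) set"] by auto
  have pat': "\<exists>i<N. pat i = p" for p using pat by (metis UNIV_I imageE mem_Collect_eq)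
  have N: "N > 0" using pat' by fastforce
  \<comment> \<open>The 8 combines the bound 2 on the sum of \<open>1 / growth j\<close> with the 4
    in the density threshold.\<close>
  define K where "K = real (2 * N) ^ n * (8 * (4 * real n) ^ n)"
  \<comment> \<open>So \<open>r k ^ n = K * growth k\<close>; rounding up to the integer
    \<open>m k\<close> at most doubles it.\<close>
  define r where "r k = root n (K * growth k)" for k
  define m where "m k = \<lceil>r k\<rceil>" for k
  have K1: "K \<ge> real (2 * N) ^ n"
  proof -
    have "1 \<le> (4 * real n) ^ n" using n by (intro one_le_power) linarith
    then have "real (2 * N) ^ n * 1 \<le> K" unfolding K_def by (intro mult_left_mono) auto
    then show ?thesis by simp
  qed
  have "1 \<le> real (2 * N) ^ n" using N by (intro one_le_power) linarith
  then have K: "K \<ge> 1" using K1 by linarith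
  have g: "growth k \<ge> real k + 27" for k using growth_ge[of k] by simp
  have r_ge: "real (2 * N) \<le> r k" for k
  proof -
    have "real (2 * N) ^ n * 1 \<le> K * growth k"
      using K1 K g[of k] by (intro mult_mono) auto
    then have "root n (real (2 * N) ^ n) \<le> r k" unfolding r_def using n by (intro real_root_le_mono) auto
    moreover have "root n (real (2 * N) ^ n) = real (2 * N)"
      using n by (intro real_root_power_cancel) auto
    ultimately show ?thesis by simp
  qed
  have r_pow: "r k ^ n = K * growth k" for k
    unfolding r_def using n K g[of k] by (intro real_root_pow_pos2) auto
  have r_le_m: "r k \<le> of_int (m k)" for k by (simp add: m_def)
  have r_1: "r k \<ge> 1" for k using r_ge[of k] N by linarith
  have m_le: "of_int (m k) \<le> 2 * r k" for k using r_1[of k] unfolding m_def by linarith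
  have m_mono: "m k \<le> m (Suc k)" for k
    unfolding m_def r_def using growth_mono[of k] K n
    by (intro ceiling_mono real_root_le_mono mult_left_mono) auto
  interpret block_substitution m pat N
  proof
    show "\<exists>i<N. pat i = p" for p by (rule pat')
    show "2 * int N \<le> m k" for k using r_ge[of k] r_le_m[of k] by linarith
  qed
  have nonuniform: "(\<Sum>i<k. real (2 * N) ^ n / of_int (m i) ^ n) \<le> 1 / (4 * (4 * real n) ^ n)" for k
  proof -
    have "(\<Sum>i<k. real (2 * N) ^ n / of_int (m i) ^ n) \<le> (\<Sum>i<k. (real (2 * N) ^ n / K) * (1 / growth i))"
    proof (rule sum_mono)
      fix i
      have "K * growth i \<le> of_int (m i) ^ n"
        using r_le_m[of i] r_1[of i] unfolding r_pow[symmetric] by (intro power_mono) auto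
      then have "real (2 * N) ^ n / of_int (m i) ^ n \<le> real (2 * N) ^ n / (K * growth i)"
        using K g[of i] r_1[of i] r_le_m[of i] by (intro divide_left_mono mult_pos_pos zero_less_power) auto
      then show "real (2 * N) ^ n / of_int (m i) ^ n \<le> (real (2 * N) ^ n / K) * (1 / growth i)" by simp
    qed
    also have "\<dots> \<le> (real (2 * N) ^ n / K) * 2"
      unfolding sum_distrib_left[symmetric] using K by (intro mult_left_mono sum_inverse_growth) auto
    also have "\<dots> = 1 / (4 * (4 * real n) ^ n)"
      using N n by (simp add: K_def field_simps)
    finally show ?thesis .
  qed
  have ln_L: "ln (of_int (L p)) \<ge> (p * ln (real (p + 27)) - p) / n" for p
  proof -
    have "m j \<noteq> 0" for j using m_ge_2[of j] by auto
    then have "ln (of_int (L p)) = (\<Sum>j<p. ln (real_of_int (m j)))"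
      unfolding L_def of_int_prod by (intro ln_prod) auto
    moreover have "ln (real (j + 27)) / n \<le> ln (real_of_int (m j))" for j
    proof -
      have "real (j + 27) \<le> K * growth j"
        using mult_mono[of 1 K "real (j + 27)" "growth j"] K g[of j] by simp
      then have "ln (real (j + 27)) \<le> ln (r j ^ n)" unfolding r_pow by (intro ln_mono) auto
      also have "\<dots> = n * ln (r j)" using r_1[of j] by (simp add: ln_realpow)
      also have "\<dots> \<le> n * ln (of_int (m j))"
        using r_1[of j] r_le_m[of j] by (intro mult_left_mono ln_mono) auto
      finally show ?thesis using n by (simp add: field_simps)
    qed
    ultimately have "(\<Sum>j<p. ln (real (j + 27)) / n) \<le> ln (of_int (L p))" by (simp add: sum_mono)
    moreover have "(p * ln (real (p + 27)) - p) / n \<le> (\<Sum>j<p. ln (real (j + 27)) / n)"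
      unfolding sum_divide_distrib[symmetric] by (intro divide_right_mono sum_ln_shift_ge) auto
    ultimately show ?thesis by linarith
  qed
  obtain p0 where p0: "\<And>p. p \<ge> p0 \<Longrightarrow>
      real (p + 28) * ln (real (p + 28)) / (2 * n) \<le> (p * ln (real (p + 27)) - p) / n - ln 2
      \<and> real (p + 28) \<le> real (p + 28) * ln (real (p + 28)) / (2 * n)"
    using eventually_conj[OF eventually_ln_product_bound[of "real n"]] n
    unfolding eventually_sequentially by auto
  \<comment> \<open>The factor \<open>8 * n\<close> collects \<open>n\<close> from the diameter of a
    cell, 2 from \<open>L p \<le> 2 * T\<close> and 4 from rounding up two block sizes.\<close>
  define C where "C = 8 * n * (2 * n * K) powr (2 / n)"
  have bound: "\<bar>repetitivity_function X T\<bar>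
      \<le> C * \<bar>T * ln T powr (2 / n) * ln (ln (ln T)) powr (4 / n)\<bar>" if T: "T \<ge> of_int (L p0)" for T
  proof -
    have "T > 0" using T L_pos[of p0] by (smt (verit) of_int_0_less_iff)
    \<comment> \<open>Minimality gives \<open>L p \<le> 2 * T\<close> for the predecessor
      \<open>p\<close>, so \<open>L (Suc k)\<close> exceeds \<open>2 * T\<close> by at most the
      factor \<open>m p * m (Suc p)\<close>.\<close>
    define k where "k = (LEAST k. 2 * T < of_int (L k))"
    have k: "2 * T < of_int (L k)" unfolding k_def using ex_L_gt by (rule LeastI_ex)
    have "\<not> k \<le> p0"
    proof
      assume "k \<le> p0"
      then have "L k \<le> L p0" using L_dvd L_pos by (simp add: zdvd_imp_le)
      then show False using k T \<open>T > 0\<close> by linarith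
    qed
    then obtain p where p: "k = Suc p" "p \<ge> p0" by (cases k) auto
    have Lp: "of_int (L p) \<le> 2 * T"
      using not_less_Least[of p "\<lambda>k. 2 * T < of_int (L k)"] p(1) unfolding k_def[symmetric] by simp
    \<comment> \<open>The argument occurring in \<open>growth (Suc p)\<close>.\<close>
    define x where "x = real (p + 28)"
    have x: "x \<ge> 28" "ln x \<ge> 1" "ln (ln x) \<ge> 1" using ln_ln_ge_1[of x] by (auto simp: x_def)
    have "(p * ln (real (p + 27)) - p) / n \<le> ln (2 * T)"
      using ln_L[of p] Lp L_pos[of p] by (smt (verit) ln_mono of_int_0_less_iff)
    then have lnT: "x * ln x / (2 * n) \<le> ln T" "x \<le> ln T"
      using p0[OF p(2)] \<open>T > 0\<close> by (auto simp: ln_mult x_def)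
    \<comment> \<open>This is how the triple logarithm of T arises: x itself is at most ln
      T.\<close>
    have "ln x \<le> ln (ln T)" using lnT x by (intro ln_mono) auto
    then have llT: "ln (ln x) \<le> ln (ln (ln T))" using x by (subst ln_le_cancel_iff) auto
    have "growth (Suc p) = x * ln x * (ln (ln x))\<^sup>2" by (simp add: growth_def x_def add_ac)
    also have "\<dots> \<le> (2 * n * ln T) * (ln (ln (ln T)))\<^sup>2"
    proof (rule mult_mono)
      show "x * ln x \<le> 2 * n * ln T" using lnT(1) n by (simp add: field_simps)
      show "(ln (ln x))\<^sup>2 \<le> (ln (ln (ln T)))\<^sup>2" using llT x by (intro power_mono) auto
      show "0 \<le> 2 * n * ln T" using lnT(2) x by auto
    qed simp
    finally have gr: "growth (Suc p) \<le> 2 * n * ln T * (ln (ln (ln T)))\<^sup>2" .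
    have lnT_pos: "ln T > 0" "ln (ln (ln T)) > 0" using lnT llT x by linarith+
    have "(r (Suc p))\<^sup>2 = (K * growth (Suc p)) powr (2 / n)"
      using n K g[of "Suc p"] unfolding r_def
      by (simp add: root_powr_inverse powr_powr flip: powr_realpow)
    also have "\<dots> \<le> (K * (2 * n * ln T * (ln (ln (ln T)))\<^sup>2)) powr (2 / n)"
      using K g[of "Suc p"] by (intro powr_mono2 mult_left_mono gr) auto
    also have "\<dots> = (2 * n * K) powr (2 / n) * ln T powr (2 / n) * ln (ln (ln T)) powr (4 / n)"
      using lnT_pos K n powr_powr[of "ln (ln (ln T))" 2 "2 / n"] by (simp add: powr_mult mult_ac)
    finally have r2: "(r (Suc p))\<^sup>2
      \<le> (2 * n * K) powr (2 / n) * ln T powr (2 / n) * ln (ln (ln T)) powr (4 / n)" .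
    have mm: "real_of_int (m p * m (Suc p)) \<le> 4 * (r (Suc p))\<^sup>2"
    proof -
      have "real_of_int (m p * m (Suc p)) \<le> of_int (m (Suc p)) * of_int (m (Suc p))"
        using m_mono[of p] m_ge_2[of "Suc p"] unfolding of_int_mult by (intro mult_right_mono) auto
      also have "\<dots> \<le> (2 * r (Suc p)) * (2 * r (Suc p))"
        using m_le[of "Suc p"] m_ge_2[of "Suc p"] r_1[of "Suc p"] by (intro mult_mono) auto
      finally show ?thesis by (simp add: power2_eq_square)
    qed
    have "repetitivity_function X T \<le> real n * real_of_int (L (Suc k))"
      using repetitivity_function_X_le[OF \<open>T > 0\<close> k] by (simp add: n_def)
    also have "\<dots> = real n * (real_of_int (L p) * real_of_int (m p * m (Suc p)))" by (simp add: p(1) L_Suc)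
    also have "\<dots> \<le> n * ((2 * T) * (4 * (r (Suc p))\<^sup>2))"
      using Lp mm \<open>T > 0\<close> m_ge_2[of p] m_ge_2[of "Suc p"] by (intro mult_left_mono mult_mono) auto
    also have "\<dots> \<le> n * ((2 * T) * (4 * ((2 * n * K) powr (2 / n) * ln T powr (2 / n) * ln (ln (ln T)) powr (4 / n))))"
      using r2 \<open>T > 0\<close> by (intro mult_left_mono) auto
    also have "\<dots> = C * (T * ln T powr (2 / n) * ln (ln (ln T)) powr (4 / n))" by (simp add: C_def)
    also have "\<dots> = C * \<bar>T * ln T powr (2 / n) * ln (ln (ln T)) powr (4 / n)\<bar>" using \<open>T > 0\<close> by simp
    finally show ?thesis using repetitivity_function_X_le(1)[OF \<open>T > 0\<close> k] by simp
  qed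
  have "repetitivity_function X \<in> O[at_top](\<lambda>T. T * ln T powr (2 / real n) * ln (ln (ln T)) powr (4 / real n))"
    by (rule bigoI[of _ C], rule eventually_mono[OF eventually_ge_at_top[of "of_int (L p0)"]])
      (use bound in simp)
  moreover have "\<not> uniform_patch_frequencies X"
    using nonuniform unfolding n_def by (rule not_uniform_patch_frequencies_X)
  ultimately show ?thesis using meyer_X repetitive_X unfolding n_def by blast
qed

end
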